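(* For every fixed $\varepsilon>0$ there is an $m_0=m_0(\varepsilon)$ such that for every integer $m\ge m_0$ and every $\mathcal{A}\in\mathscr{A}_m$, $$\left(\left\lfloor\frac{R_m}{2}\right\rfloor+\frac12-\sqrt{\left\lfloor\frac{R_m}{2}\right\rfloor^2-3\left\lfloor\frac{R_m}{2}\right\rfloor+\frac14}-\varepsilon\right)m\le |\mathcal{A}|^2\le \left(\left\lfloor\frac{R_m}{2}\right\rfloor+\frac12+\sqrt{\left\lfloor\frac{R_m}{2}\right\rfloor^2-3\left\lfloor\frac{R_m}{2}\right\rfloor+\frac14}+\varepsilon\right)m.$$
   Context: For a positive integer $m$ let $\mathbb{Z}_m=\mathbb{Z}/m\mathbb{Z}$. For $\mathcal{A}\subseteq \mathbb{Z}_m$ and $n\in\mathbb{Z}_m$ put $\sigma_{\mathcal{A}}(n)=\#\{(a,a')\in\mathcal{A}^2: a+a'\equiv n \pmod m\}$ (ordered pairs). The Ruzsa number $R_m$ is the least integer $r$ such that there is a subset $\mathcal{A}\subseteq\mathbb{Z}_m$ with $1\le \sigma_{\mathcal{A}}(n)\le r$ for all $n\in\mathbb{Z}_m$. $\mathscr{A}_m$ denotes the set of all subsets $\mathcal{A}\subseteq[0,m-1]$ of integers (identified with subsets of $\mathbb{Z}_m$) such that $1\le\sigma_{\mathcal{A}}(n)\le R_m$ for all $n\in\mathbb{Z}_m$. It is known that $R_m\ge 6$ for $m>45$, so for large $m$ the quantity under the square root is positive. *)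

theory Defs
  imports "HOL-Analysis.Analysis" "HOL-Number_Theory.Cong"
begin

text \<open>
  Residue classes modulo \<open>m\<close> (with \<open>m > 0\<close>) are represented by \<open>{0..<m}\<close>, and a subset of
  \<open>\<int>/m\<int>\<close> by the corresponding subset of \<open>{0..<m}\<close>.
\<close>

definition rep_count :: "nat \<Rightarrow> nat set \<Rightarrow> nat \<Rightarrow> nat" where
  "rep_count m A n = card {(a, a'). a \<in> A \<and> a' \<in> A \<and> [a + a' = n] (mod m)}"

definition ruzsa_number :: "nat \<Rightarrow> nat" where
  "ruzsa_number m =
     (LEAST r. \<exists>A. A \<subseteq> {0..<m} \<and> (\<forall>n\<in>{0..<m}. 1 \<le> rep_count m A n \<and> rep_count m A n \<le> r))"

definition ruzsa_sets :: "nat \<Rightarrow> nat set set" where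
  "ruzsa_sets m =
     {A. A \<subseteq> {0..<m} \<and>
         (\<forall>n\<in>{0..<m}. 1 \<le> rep_count m A n \<and> rep_count m A n \<le> ruzsa_number m)}"

text \<open>The minimum defining \<^const>\<open>ruzsa_number\<close> is over a nonempty set, hence attained.\<close>

lemma ruzsa_sets_nonempty: "ruzsa_sets m \<noteq> {}"
proof -
  let ?P = "\<lambda>r. \<exists>A. A \<subseteq> {0..<m} \<and>
      (\<forall>n\<in>{0..<m}. 1 \<le> rep_count m A n \<and> rep_count m A n \<le> r)"
  have "1 \<le> rep_count m {0..<m} n \<and> rep_count m {0..<m} n \<le> m * m" if n: "n \<in> {0..<m}" for n
  proof -
    let ?S = "{(a, a'). a \<in> {0..<m} \<and> a' \<in> {0..<m} \<and> [a + a' = n] (mod m)}"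
    have sub: "?S \<subseteq> {0..<m} \<times> {0..<m}" by auto
    then have fin: "finite ?S" by (rule finite_subset) simp
    have "(n, 0) \<in> ?S" using n by auto
    then have "card ?S > 0" using fin card_gt_0_iff by blast
    moreover have "card ?S \<le> card ({0..<m} \<times> {0..<m})"
      using sub by (intro card_mono) auto
    ultimately show ?thesis by (simp add: rep_count_def card_cartesian_product)
  qed
  then have "?P (m * m)" by blast
  then have "?P (LEAST r. ?P r)" by (rule LeastI)
  then show ?thesis by (auto simp: ruzsa_sets_def ruzsa_number_def)
qed

end

theory Submission
  imports Defs
begin

text \<open>
  Write \<open>k = \<lfloor>R\<^sub>m/2\<rfloor>\<close> and \<open>S = |A|\<^sup>2/m\<close>. The second moment of the representation
  function is the additive energy of \<open>A\<close>, hence also the second moment of the difference function;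
  the latter takes the value \<open>|A|\<close> at \<open>0\<close>, so Cauchy-Schwarz bounds the energy below by
  \<open>(S + S\<^sup>2 - o(1)) m\<close>. On the other hand the representation function is even, hence in
  \<open>[2, 2k]\<close>, outside of the residues \<open>2a\<close> with \<open>a \<in> A\<close>, so summing \<open>(\<sigma> - 2)(\<sigma> - 2k) \<le> 0\<close>
  bounds the energy above by \<open>((2k + 2) S - 4k + o(1)) m\<close>. Comparing the two gives
  \<open>(S - k - 1/2)\<^sup>2 \<le> k\<^sup>2 - 3k + 1/4 + o(1)\<close>. The error is absorbed uniformly in \<open>k\<close>
  because the digit construction gives \<open>R\<^sub>m = O(\<surd>m)\<close>.
\<close>

section \<open>Moments of fibre sizes\<close>

lemma sum_card_fibres:
  assumes "finite P" "finite T" "f ` P \<subseteq> T"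
  shows "(\<Sum>t\<in>T. card {p \<in> P. f p = t}) = card P"
proof -
  have "P = (\<Union>t\<in>T. {p \<in> P. f p = t})" using assms(3) by auto
  then have "card P = card (\<Union>t\<in>T. {p \<in> P. f p = t})" by simp
  also have "\<dots> = (\<Sum>t\<in>T. card {p \<in> P. f p = t})"
    using assms by (intro card_UN_disjoint) auto
  finally show ?thesis by simp
qed

text \<open>The square of a fibre size counts ordered pairs inside that fibre, so second moments
  count collisions of \<open>f\<close>.\<close>

lemma sum_card_fibres_squared:
  assumes "finite P" "finite T" "f ` P \<subseteq> T"
  shows "(\<Sum>t\<in>T. (card {p \<in> P. f p = t})\<^sup>2) = card {(p, q). p \<in> P \<and> q \<in> P \<and> f p = f q}"
proof -
  let ?F = "\<lambda>t. {p \<in> P. f p = t}"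
  have "{(p, q). p \<in> P \<and> q \<in> P \<and> f p = f q} = (\<Union>t\<in>T. ?F t \<times> ?F t)"
    using assms(3) by auto
  then have "card {(p, q). p \<in> P \<and> q \<in> P \<and> f p = f q} = card (\<Union>t\<in>T. ?F t \<times> ?F t)" by simp
  also have "\<dots> = (\<Sum>t\<in>T. card (?F t \<times> ?F t))"
    using assms by (intro card_UN_disjoint) auto
  finally show ?thesis by (simp add: card_cartesian_product power2_eq_square)
qed

section \<open>The representation function\<close>

lemma rep_count_fibre:
  assumes "n < m"
  shows "rep_count m A n = card {p \<in> A \<times> A. (fst p + snd p) mod m = n}"
  unfolding rep_count_def using assms
  by (intro arg_cong[where f = card]) (auto simp: cong_def)

lemma sum_rep_count:
  assumes "m > 0" "finite A"
  shows "(\<Sum>n\<in>{0..<m}. rep_count m A n) = (card A)\<^sup>2"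
proof -
  have "(\<Sum>n\<in>{0..<m}. rep_count m A n)
      = (\<Sum>n\<in>{0..<m}. card {p \<in> A \<times> A. (fst p + snd p) mod m = n})"
    by (intro sum.cong) (auto simp: rep_count_fibre)
  also have "\<dots> = card (A \<times> A)"
    using assms by (intro sum_card_fibres) auto
  finally show ?thesis by (simp add: card_cartesian_product power2_eq_square)
qed

text \<open>Both sides count additive quadruples: \<open>a + b = c + d\<close> rearranges to
  \<open>a - c = d - b\<close>, and \<open>h\<close> is this relabelling. Differences live in
  \<open>int\<close> to avoid truncated subtraction.\<close>

lemma sum_rep_count_squared:
  assumes "m > 0" "finite A"
  shows "(\<Sum>n\<in>{0..<m}. (rep_count m A n)\<^sup>2)
       = (\<Sum>t\<in>{0..<int m}. (card {p \<in> A \<times> A. (int (fst p) - int (snd p)) mod int m = t})\<^sup>2)"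
proof -
  define f where "f = (\<lambda>p::nat \<times> nat. (fst p + snd p) mod m)"
  define g where "g = (\<lambda>p::nat \<times> nat. (int (fst p) - int (snd p)) mod int m)"
  let ?P = "A \<times> A"
  let ?X = "{(p, q). p \<in> ?P \<and> q \<in> ?P \<and> f p = f q}"
  let ?Y = "{(p, q). p \<in> ?P \<and> q \<in> ?P \<and> g p = g q}"
  have fg: "f (a, b) = f (c, d) \<longleftrightarrow> g (a, c) = g (d, b)" for a b c d
  proof -
    have "f (a, b) = f (c, d) \<longleftrightarrow> [a + b = c + d] (mod m)"
      by (simp add: f_def cong_def)
    also have "\<dots> \<longleftrightarrow> [int (a + b) = int (c + d)] (mod int m)"
      by (simp only: cong_int_iff)
    also have "\<dots> \<longleftrightarrow> int m dvd (int a - int c) - (int d - int b)"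
      by (simp add: cong_iff_dvd_diff algebra_simps)
    also have "\<dots> \<longleftrightarrow> g (a, c) = g (d, b)"
      by (simp add: g_def mod_eq_dvd_iff)
    finally show ?thesis .
  qed
  define h :: "(nat \<times> nat) \<times> (nat \<times> nat) \<Rightarrow> (nat \<times> nat) \<times> (nat \<times> nat)"
    where "h = (\<lambda>((a, b), (c, d)). ((a, c), (d, b)))"
  define h' :: "(nat \<times> nat) \<times> (nat \<times> nat) \<Rightarrow> (nat \<times> nat) \<times> (nat \<times> nat)"
    where "h' = (\<lambda>((a, c), (d, b)). ((a, b), (c, d)))"
  have "bij_betw h ?X ?Y"
    by (rule bij_betw_byWitness[where f' = h']) (auto simp: h_def h'_def fg)
  then have "card ?X = card ?Y" by (rule bij_betw_same_card)
  moreover have "(\<Sum>n\<in>{0..<m}. (rep_count m A n)\<^sup>2)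
      = (\<Sum>n\<in>{0..<m}. (card {p \<in> ?P. f p = n})\<^sup>2)"
    by (intro sum.cong) (auto simp: rep_count_fibre f_def)
  moreover have "\<dots> = card ?X"
    using assms by (intro sum_card_fibres_squared) (auto simp: f_def)
  moreover have "(\<Sum>t\<in>{0..<int m}. (card {p \<in> ?P. g p = t})\<^sup>2) = card ?Y"
    using assms by (intro sum_card_fibres_squared) (auto simp: g_def)
  ultimately show ?thesis by (simp add: g_def)
qed

text \<open>The difference 0 has exactly \<open>card A\<close> representations. Splitting it off
  before Cauchy-Schwarz on the nonzero differences produces the extra term
  \<open>(card A)\<^sup>2\<close>.\<close>

lemma sum_rep_count_squared_ge:
  assumes "m > 0" "A \<subseteq> {0..<m}"
  shows "(\<Sum>n\<in>{0..<m}. (real (rep_count m A n))\<^sup>2)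
       \<ge> (real (card A))\<^sup>2 + ((real (card A))\<^sup>2 - real (card A))\<^sup>2 / real m"
proof -
  define d where
    "d = (\<lambda>t. real (card {p \<in> A \<times> A. (int (fst p) - int (snd p)) mod int m = t}))"
  let ?T = "{0..<int m}"
  let ?a = "real (card A)"
  have fin: "finite A" using assms(2) finite_subset by blast
  have "{p \<in> A \<times> A. (int (fst p) - int (snd p)) mod int m = 0} = (\<lambda>x. (x, x)) ` A"
  proof -
    have "x = y" if "x \<in> A" "y \<in> A" "int m dvd int x - int y" for x y
    proof -
      have "[int x = int y] (mod int m)" using that by (simp add: cong_iff_dvd_diff)
      then have "[x = y] (mod m)" by (simp add: cong_int_iff)
      then show ?thesis using that assms(2)
        by (metis atLeastLessThan_iff cong_less_modulus_unique_nat subsetD)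
    qed
    then show ?thesis by (fastforce simp: mod_eq_0_iff_dvd)
  qed
  then have d0: "d 0 = ?a"
    by (simp add: d_def card_image inj_on_def)
  have "(\<Sum>t\<in>?T. d t) = real (card (A \<times> A))"
    unfolding d_def of_nat_sum[symmetric]
    using assms(1) fin by (intro arg_cong[where f = real] sum_card_fibres) auto
  then have total: "(\<Sum>t\<in>?T. d t) = ?a\<^sup>2"
    by (simp add: card_cartesian_product power2_eq_square)
  have zero: "0 \<in> ?T" using assms(1) by simp
  have "(\<Sum>t\<in>?T - {0}. d t) = ?a\<^sup>2 - ?a"
    using total d0 sum.remove[OF _ zero, of d] by simp
  then have "(?a\<^sup>2 - ?a)\<^sup>2 \<le> (\<Sum>t\<in>?T - {0}. (d t)\<^sup>2) * card (?T - {0})"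
    using sum_squared_le_sum_of_squares[of d "?T - {0}"] by simp
  \<comment> \<open>Enlarging the number \<open>m - 1\<close> of nonzero residues to
    \<open>m\<close> costs only lower-order terms.\<close>
  also have "\<dots> \<le> (\<Sum>t\<in>?T - {0}. (d t)\<^sup>2) * real m"
    by (intro mult_left_mono sum_nonneg) (use zero in auto)
  finally have "(?a\<^sup>2 - ?a)\<^sup>2 / real m \<le> (\<Sum>t\<in>?T - {0}. (d t)\<^sup>2)"
    using assms(1) by (simp add: divide_le_eq)
  then have "?a\<^sup>2 + (?a\<^sup>2 - ?a)\<^sup>2 / real m \<le> (\<Sum>t\<in>?T. (d t)\<^sup>2)"
    using sum.remove[OF _ zero, of "\<lambda>t. (d t)\<^sup>2"] d0 by simp
  also have "\<dots> = (\<Sum>n\<in>{0..<m}. (real (rep_count m A n))\<^sup>2)"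
    using sum_rep_count_squared[OF assms(1) fin]
    unfolding d_def of_nat_power[symmetric] of_nat_sum[symmetric] by simp
  finally show ?thesis .
qed

text \<open>Swapping \<open>(a, a')\<close> is an involution on the solutions; an odd count forces a
  fixed point \<open>a = a'\<close>.\<close>

lemma odd_rep_count_double:
  assumes "finite A" "odd (rep_count m A n)"
  shows "\<exists>u\<in>A. [2 * u = n] (mod m)"
proof (rule ccontr)
  assume none: "\<not> (\<exists>u\<in>A. [2 * u = n] (mod m))"
  let ?S = "{(a, a'). a \<in> A \<and> a' \<in> A \<and> [a + a' = n] (mod m)}"
  let ?L = "{(a, a'). (a, a') \<in> ?S \<and> a < a'}"
  let ?G = "{(a, a'). (a, a') \<in> ?S \<and> a' < a}"
  have fin: "finite ?S" by (rule finite_subset[of _ "A \<times> A"]) (use assms(1) in auto)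
  have "a \<noteq> a'" if "(a, a') \<in> ?S" for a a'
    using that none by (auto simp: mult_2)
  then have "?S = ?L \<union> ?G" by (auto simp: less_le not_less)
  moreover have "card (?L \<union> ?G) = card ?L + card ?G"
    by (intro card_Un_disjoint) (auto intro: finite_subset[OF _ fin])
  moreover have "card ?L = card ?G"
    by (intro bij_betw_same_card[of prod.swap] bij_betw_byWitness[where f' = prod.swap])
      (auto simp: add.commute)
  ultimately have "rep_count m A n = 2 * card ?L"
    unfolding rep_count_def mult_2 by metis
  then show False using assms(2) by simp
qed

lemma card_odd_rep_count_le:
  assumes "finite A"
  shows "card {n \<in> {0..<m}. odd (rep_count m A n)} \<le> card A"
proof -
  have "{n \<in> {0..<m}. odd (rep_count m A n)} \<subseteq> (\<lambda>u. (2 * u) mod m) ` A"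
    using odd_rep_count_double[OF assms] by (fastforce simp: cong_def)
  then show ?thesis by (rule surj_card_le[OF assms])
qed

text \<open>Even counts lie in \<open>[2, 2k]\<close>, where the product is nonpositive. Odd counts
  may reach 1 or \<open>2k + 1\<close>, but they occur for at most \<open>card A\<close>
  residues.\<close>

lemma sum_rep_count_quadratic_le:
  fixes r :: nat
  assumes "finite A" and bounds: "\<forall>n\<in>{0..<m}. 1 \<le> rep_count m A n \<and> rep_count m A n \<le> r"
  defines "k \<equiv> real (r div 2)"
  shows "(\<Sum>n\<in>{0..<m}. (real (rep_count m A n) - 2) * (real (rep_count m A n) - 2 * k))
       \<le> 2 * k * real (card A)"
proof -
  let ?q = "\<lambda>n. (real (rep_count m A n) - 2) * (real (rep_count m A n) - 2 * k)"
  let ?O = "{n \<in> {0..<m}. odd (rep_count m A n)}"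
  have pointwise: "?q n \<le> (if odd (rep_count m A n) then 2 * k else 0)" if "n \<in> {0..<m}" for n
  proof (cases "odd (rep_count m A n)")
    case True
    then have "1 \<le> rep_count m A n" "rep_count m A n \<le> 2 * (r div 2) + 1"
      using bounds that by force+
    then have "0 \<le> real (rep_count m A n) - 1" "real (rep_count m A n) \<le> 2 * k + 1"
      by (simp_all add: k_def)
    \<comment> \<open>This product and \<open>?q n\<close> differ by the constant
      \<open>2 * k - 1\<close>.\<close>
    then have "(real (rep_count m A n) - 1) * (real (rep_count m A n) - (2 * k + 1)) \<le> 0"
      by (intro mult_nonneg_nonpos) auto
    then show ?thesis using True by (simp add: algebra_simps)
  next
    case False
    then have "2 \<le> rep_count m A n" "rep_count m A n \<le> 2 * (r div 2)"
      using bounds that by (force elim!: evenE)+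
    then have "0 \<le> real (rep_count m A n) - 2" "real (rep_count m A n) \<le> 2 * k"
      by (simp_all add: k_def)
    then show ?thesis using False by (simp add: mult_nonneg_nonpos)
  qed
  then have "(\<Sum>n\<in>{0..<m}. ?q n) \<le> (\<Sum>n\<in>{0..<m}. if odd (rep_count m A n) then 2 * k else 0)"
    by (rule sum_mono)
  also have "\<dots> = 2 * k * real (card ?O)"
    by (subst sum.inter_filter[symmetric]) simp_all
  also have "\<dots> \<le> 2 * k * real (card A)"
    using card_odd_rep_count_le[OF assms(1)] by (intro mult_left_mono) (simp_all add: k_def)
  finally show ?thesis .
qed

section \<open>A square root bound for the Ruzsa number\<close>

text \<open>The first summand determines the second modulo \<open>m\<close>.\<close>

lemma rep_count_le_card:
  assumes "A \<subseteq> {0..<m}"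
  shows "rep_count m A n \<le> card A"
  unfolding rep_count_def
proof (rule card_inj_on_le[where f = fst])
  show "finite A" using assms finite_subset by blast
  show "inj_on fst {(a, a'). a \<in> A \<and> a' \<in> A \<and> [a + a' = n] (mod m)}"
  proof (rule inj_onI, clarsimp)
    fix a b c assume *: "[a + b = n] (mod m)" "[a + c = n] (mod m)" "b \<in> A" "c \<in> A"
    then have "[a + b = a + c] (mod m)" by (meson cong_sym cong_trans)
    then have "[b = c] (mod m)" by (simp add: cong_add_lcancel_nat)
    then show "b = c" using * assms
      by (metis atLeastLessThan_iff cong_less_modulus_unique_nat subsetD)
  qed
qed auto

lemma ruzsa_number_le:
  assumes "m \<le> s * s"
  shows "ruzsa_number m \<le> 2 * s"
  unfolding ruzsa_number_def
proof (rule Least_le, intro exI conjI ballI)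
  \<comment> \<open>The possible contributions of the two digits in base \<open>s\<close>: every
    \<open>n < s * s\<close> is a sum of a low and a high part. For \<open>n < m\<close> both parts
    are at most \<open>n\<close>, so they survive the cut to \<open>{0..<m}\<close>.\<close>
  let ?B = "{..<s} \<union> (\<lambda>i. i * s) ` {..<s}"
  let ?A = "?B \<inter> {0..<m}"
  show sub: "?A \<subseteq> {0..<m}" by auto
  fix n assume n: "n \<in> {0..<m}"
  have "card ?A \<le> card ?B" by (intro card_mono) auto
  also have "\<dots> \<le> card {..<s} + card ((\<lambda>i. i * s) ` {..<s})" by (rule card_Un_le)
  also have "\<dots> \<le> 2 * s" using card_image_le[of "{..<s}" "\<lambda>i. i * s"] by simp
  finally show "rep_count m ?A n \<le> 2 * s"
    using rep_count_le_card[OF sub, of n] by simp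
  have "s > 0" using assms n by (cases s) auto
  moreover have "n < s * s" using assms n by simp
  ultimately have "n div s < s" "n mod s < s" by (simp_all add: less_mult_imp_div_less)
  moreover have "n div s * s < m" "n mod s < m"
    using n by (auto intro: le_less_trans[OF div_times_less_eq_dividend]
        le_less_trans[OF mod_less_eq_dividend])
  ultimately have "(n div s * s, n mod s) \<in> {(a, a'). a \<in> ?A \<and> a' \<in> ?A \<and> [a + a' = n] (mod m)}"
    by auto
  moreover have "finite {(a, a'). a \<in> ?A \<and> a' \<in> ?A \<and> [a + a' = n] (mod m)}"
    by (rule finite_subset[of _ "?A \<times> ?A"]) auto
  ultimately show "1 \<le> rep_count m ?A n"
    unfolding rep_count_def by (metis (no_types, lifting) One_nat_def Suc_leI card_gt_0_iff empty_iff)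
qed

lemma ruzsa_number_le_sqrt:
  assumes "m > 0"
  shows "real (ruzsa_number m) \<le> 4 * sqrt (real m)"
proof -
  define s where "s = nat \<lceil>sqrt (real m)\<rceil>"
  have s: "sqrt (real m) \<le> real s" "real s \<le> sqrt (real m) + 1"
    unfolding s_def by (simp_all add: of_nat_ceiling)
  have "real m = sqrt (real m) * sqrt (real m)" by simp
  also have "\<dots> \<le> real s * real s" using s(1) by (intro mult_mono) auto
  finally have "m \<le> s * s" by (simp flip: of_nat_mult)
  then have "real (ruzsa_number m) \<le> 2 * real s" using ruzsa_number_le[of m s] by linarith
  moreover have "1 \<le> sqrt (real m)" using assms by simp
  ultimately show ?thesis using s(2) by linarith
qed

section \<open>The quadratic inequality\<close>

text \<open>The first bound averages counts that are at most \<open>2k + 1\<close>. The second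
  compares the lower and upper bounds for the energy and divides by \<open>m\<close>.\<close>

lemma ruzsa_sets_quadratic:
  assumes "m > 0" "A \<in> ruzsa_sets m"
  defines "k \<equiv> real (ruzsa_number m div 2)" and "a \<equiv> real (card A)"
  shows "a\<^sup>2 \<le> (2 * k + 1) * real m"
    and "(a\<^sup>2 / m)\<^sup>2 - (2 * k + 1) * (a\<^sup>2 / m) + 4 * k \<le> 2 * k * a / m + 2 * a ^ 3 / (real m)\<^sup>2"
proof -
  let ?s = "\<lambda>n. real (rep_count m A n)"
  have A: "A \<subseteq> {0..<m}" and
    bounds: "\<forall>n\<in>{0..<m}. 1 \<le> rep_count m A n \<and> rep_count m A n \<le> ruzsa_number m"
    using assms(2) by (auto simp: ruzsa_sets_def)
  have fin: "finite A" using A finite_subset by blast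
  have first: "(\<Sum>n\<in>{0..<m}. ?s n) = a\<^sup>2"
    unfolding a_def of_nat_power[symmetric] of_nat_sum[symmetric]
    using sum_rep_count[OF assms(1) fin] by simp
  have "real (ruzsa_number m) \<le> 2 * k + 1" by (simp add: k_def)
  then have "?s n \<le> 2 * k + 1" if "n \<in> {0..<m}" for n
    using bounds that by fastforce
  then have "(\<Sum>n\<in>{0..<m}. ?s n) \<le> of_nat (card {0..<m}) * (2 * k + 1)"
    by (rule sum_bounded_above)
  then show "a\<^sup>2 \<le> (2 * k + 1) * real m" using first by (simp add: mult.commute)
  have "(\<Sum>n\<in>{0..<m}. (?s n - 2) * (?s n - 2 * k))
      = (\<Sum>n\<in>{0..<m}. (?s n)\<^sup>2 - (2 * k + 2) * ?s n + 4 * k)"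
    by (intro sum.cong) (auto simp: algebra_simps power2_eq_square)
  also have "\<dots> = (\<Sum>n\<in>{0..<m}. (?s n)\<^sup>2) - (2 * k + 2) * a\<^sup>2 + 4 * k * m"
    by (simp add: sum.distrib sum_subtractf sum_distrib_left[symmetric] first)
  finally have "(\<Sum>n\<in>{0..<m}. (?s n)\<^sup>2) - (2 * k + 2) * a\<^sup>2 + 4 * k * m \<le> 2 * k * a"
    using sum_rep_count_quadratic_le[OF fin bounds] by (simp add: k_def a_def)
  moreover have "a\<^sup>2 + (a\<^sup>2 - a)\<^sup>2 / m \<le> (\<Sum>n\<in>{0..<m}. (?s n)\<^sup>2)"
    using sum_rep_count_squared_ge[OF assms(1) A] by (simp add: a_def)
  ultimately have "a\<^sup>2 + (a\<^sup>2 - a)\<^sup>2 / m - (2 * k + 2) * a\<^sup>2 + 4 * k * m \<le> 2 * k * a" by linarith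
  \<comment> \<open>Expand the square and drop the nonnegative \<open>a\<^sup>2\<close>.\<close>
  moreover have "(a\<^sup>2 - a)\<^sup>2 / m \<ge> (a ^ 4 - 2 * a ^ 3) / m"
    by (intro divide_right_mono)
      (auto simp: algebra_simps power2_eq_square power3_eq_cube power4_eq_xxxx)
  ultimately have "(a ^ 4 - 2 * a ^ 3) / m - (2 * k + 1) * a\<^sup>2 + 4 * k * m \<le> 2 * k * a"
    by (simp add: algebra_simps)
  then have "((a ^ 4 - 2 * a ^ 3) / m - (2 * k + 1) * a\<^sup>2 + 4 * k * m) / m \<le> 2 * k * a / m"
    by (rule divide_right_mono) simp
  moreover have "((a ^ 4 - 2 * a ^ 3) / m - (2 * k + 1) * a\<^sup>2 + 4 * k * m) / m
      = (a\<^sup>2 / m)\<^sup>2 - (2 * k + 1) * (a\<^sup>2 / m) + 4 * k - 2 * a ^ 3 / (real m)\<^sup>2"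
    using assms(1) by (simp add: field_simps power2_eq_square power3_eq_cube power4_eq_xxxx)
  ultimately show "(a\<^sup>2 / m)\<^sup>2 - (2 * k + 1) * (a\<^sup>2 / m) + 4 * k \<le> 2 * k * a / m + 2 * a ^ 3 / (real m)\<^sup>2"
    by linarith
qed

section \<open>Absorbing the error into \<epsilon>, uniformly in \<open>k\<close>\<close>

lemma abs_le_sqrt_add:
  fixes y D e \<epsilon> :: real
  assumes "y\<^sup>2 \<le> D + e" "e \<le> 2 * \<epsilon> * sqrt D + \<epsilon>\<^sup>2" "0 \<le> D" "0 \<le> \<epsilon>"
  shows "\<bar>y\<bar> \<le> sqrt D + \<epsilon>"
proof -
  have "y\<^sup>2 \<le> (sqrt D + \<epsilon>)\<^sup>2" using assms by (simp add: power2_sum mult.commute mult.left_commute)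
  then show ?thesis using assms by (simp add: abs_le_square_iff[symmetric])
qed

text \<open>Here \<open>x\<close> stands for the square root of \<open>m\<close>. The hypothesis
  gives \<open>a \<le> w * x\<close> with \<open>w = sqrt (2 * k + 1)\<close>, and both error terms
  increase with \<open>a\<close>.\<close>

lemma error_term_le:
  fixes a x k :: real
  assumes "x > 0" "a \<ge> 0" "k \<ge> 0" "a\<^sup>2 \<le> (2 * k + 1) * x\<^sup>2"
  shows "2 * k * a / x\<^sup>2 + 2 * a ^ 3 / (x\<^sup>2)\<^sup>2 \<le> 2 * (3 * k + 1) * sqrt (2 * k + 1) / x"
proof -
  define w where "w = sqrt (2 * k + 1)"
  have w: "w \<ge> 0" "w\<^sup>2 = 2 * k + 1" using assms(3) by (simp_all add: w_def)
  have "a\<^sup>2 \<le> (w * x)\<^sup>2" using assms(4) w by (simp add: power_mult_distrib)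
  then have a: "a \<le> w * x" using w assms(1) by (simp add: power2_le_iff_abs_le)
  have "2 * k * a / x\<^sup>2 + 2 * a ^ 3 / (x\<^sup>2)\<^sup>2
      \<le> 2 * k * (w * x) / x\<^sup>2 + 2 * (w * x) ^ 3 / (x\<^sup>2)\<^sup>2"
    using a assms by (intro add_mono divide_right_mono mult_left_mono power_mono) auto
  also have "\<dots> = 2 * (k + w\<^sup>2) * w / x"
    using assms(1) by (simp add: field_simps power2_eq_square power3_eq_cube)
  finally show ?thesis using w by (simp add: w_def algebra_simps)
qed

text \<open>The error has order \<open>k * sqrt k / x\<close>, while the allowed slack contains
  \<open>2 * \<epsilon> * sqrt D\<close> of order \<open>\<epsilon> * k\<close>, where
  \<open>D\<close> is the radicand. As \<open>k \<le> 2 * x\<close>, the ratio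
  \<open>sqrt k / x\<close> is small for large \<open>x\<close>.\<close>

lemma deviation_le:
  fixes y k x \<epsilon> :: real
  assumes k: "k \<in> \<nat>" and kx: "k \<le> 2 * x" and \<epsilon>: "\<epsilon> > 0"
    and x: "x \<ge> 5000" "x \<ge> 5000 / \<epsilon>\<^sup>2"
    and y: "y\<^sup>2 \<le> k\<^sup>2 - 3 * k + 1/4 + 2 * (3 * k + 1) * sqrt (2 * k + 1) / x"
  shows "\<bar>y\<bar> \<le> sqrt (k\<^sup>2 - 3 * k + 1/4) + \<epsilon>"
proof -
  define e where "e = 2 * (3 * k + 1) * sqrt (2 * k + 1) / x"
  have x0: "x > 0" using x by simp
  have x\<epsilon>: "5000 \<le> x * \<epsilon>\<^sup>2" using x(2) \<epsilon> by (simp add: pos_divide_le_eq)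
  from k obtain n :: nat where n: "k = real n" by (auto simp: Nats_def)
  consider "n = 0" | "n = 1 \<or> n = 2" | "n \<ge> 3" by linarith
  then show ?thesis
  proof cases
    case 1
    \<comment> \<open>For \<open>k = 0\<close> the slack \<open>\<epsilon>\<^sup>2\<close> alone
      suffices.\<close>
    have "e = 2 / x" using 1 n by (simp add: e_def)
    also have "\<dots> \<le> \<epsilon>\<^sup>2" using x\<epsilon> x0 by (simp add: divide_le_eq mult.commute)
    finally have "e \<le> 2 * \<epsilon> * sqrt (k\<^sup>2 - 3 * k + 1/4) + \<epsilon>\<^sup>2"
      using 1 n \<epsilon> by (simp add: add_increasing)
    then show ?thesis
      using y 1 n \<epsilon> by (intro abs_le_sqrt_add[of _ _ e]) (auto simp: e_def)
  next
    case 2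
    \<comment> \<open>The radicand is \<open>-7/4\<close>, so the hypothesis is contradictory; this takes the place of the
      known bound \<open>R\<^sub>m \<ge> 6\<close>.\<close>
    have "sqrt (2 * k + 1) \<le> sqrt 9" using 2 n by (intro real_sqrt_le_mono) auto
    then have "2 * (3 * k + 1) * sqrt (2 * k + 1) \<le> 2 * 7 * 3"
      using 2 n by (intro mult_mono) auto
    then have "e \<le> 42 / 5000"
      unfolding e_def using x by (intro frac_le) auto
    moreover have "k\<^sup>2 - 3 * k + 1/4 = -7/4" using 2 n by (auto simp: power2_eq_square)
    ultimately have "y\<^sup>2 < 0" using y unfolding e_def by linarith
    then show ?thesis by (simp add: not_less[symmetric])
  next
    case 3
    then have k3: "k \<ge> 3" using n by simp
    have "k * 3 \<le> k * k" using k3 by (intro mult_left_mono) auto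
    \<comment> \<open>This product is 36 times the radicand minus \<open>k\<^sup>2\<close>. The
      constant \<open>1/6\<close> below is sharp at \<open>k = 3\<close>.\<close>
    moreover have "0 \<le> (k - 3) * (35 * k - 3)" using k3 by (intro mult_nonneg_nonneg) auto
    ultimately have "(k / 6)\<^sup>2 \<le> k\<^sup>2 - 3 * k + 1/4" and D: "0 \<le> k\<^sup>2 - 3 * k + 1/4"
      by (simp_all add: power2_eq_square algebra_simps)
    then have D6: "k / 6 \<le> sqrt (k\<^sup>2 - 3 * k + 1/4)" by (intro real_le_rsqrt)
    \<comment> \<open>The threshold 5000 exceeds \<open>2 * 48\<^sup>2 = 4608\<close>. The 48 is
      chosen so that the final bound \<open>16 * k * \<epsilon> / 48\<close> equals
      \<open>2 * \<epsilon> * (k / 6)\<close>.\<close>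
    have "k \<le> x * (\<epsilon> / 48)\<^sup>2 * x"
    proof -
      have "2 \<le> x * (\<epsilon> / 48)\<^sup>2" using x\<epsilon> by (simp add: power_divide)
      then have "2 * x \<le> x * (\<epsilon> / 48)\<^sup>2 * x" using x0 by (intro mult_right_mono) auto
      then show ?thesis using kx by linarith
    qed
    then have "k \<le> (x * \<epsilon> / 48)\<^sup>2" by (simp add: power2_eq_square mult_ac)
    then have "sqrt k \<le> x * \<epsilon> / 48" using x0 \<epsilon> by (intro real_le_lsqrt) auto
    moreover have "sqrt (2 * k + 1) \<le> 2 * sqrt k"
    proof -
      have "sqrt (2 * k + 1) \<le> sqrt (4 * k)" using k3 by (intro real_sqrt_le_mono) auto
      then show ?thesis by (simp add: real_sqrt_mult)
    qed
    ultimately have "sqrt (2 * k + 1) \<le> 2 * (x * \<epsilon> / 48)" by linarith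
    then have "2 * (3 * k + 1) * sqrt (2 * k + 1) \<le> 2 * (4 * k) * (2 * (x * \<epsilon> / 48))"
      by (rule mult_mono[rotated]) (use k3 in auto)
    then have "e \<le> 2 * \<epsilon> * (k / 6)"
      unfolding e_def using x0 by (simp add: divide_le_eq mult.commute mult.left_commute)
    also have "\<dots> \<le> 2 * \<epsilon> * sqrt (k\<^sup>2 - 3 * k + 1/4)"
      using D6 \<epsilon> by (intro mult_left_mono) auto
    finally have "e \<le> 2 * \<epsilon> * sqrt (k\<^sup>2 - 3 * k + 1/4) + \<epsilon>\<^sup>2" by (simp add: add_increasing2)
    then show ?thesis
      using y D \<epsilon> by (intro abs_le_sqrt_add[of _ _ e]) (auto simp: e_def)
  qed
qed

theorem theorem2:
  fixes \<epsilon> :: real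
  assumes "\<epsilon> > 0"
  shows "\<exists>m\<^sub>0 > 0. \<forall>m::nat. m \<ge> m\<^sub>0 \<longrightarrow> (\<forall>A \<in> ruzsa_sets m.
           (let k = real_of_int \<lfloor>real (ruzsa_number m) / 2\<rfloor> in
              (k + 1/2 - sqrt (k\<^sup>2 - 3 * k + 1/4) - \<epsilon>) * real m \<le> (real (card A))\<^sup>2 \<and>
              (real (card A))\<^sup>2 \<le> (k + 1/2 + sqrt (k\<^sup>2 - 3 * k + 1/4) + \<epsilon>) * real m))"
proof -
  \<comment> \<open>\<open>X\<close> is the threshold for \<open>sqrt m\<close> required by
    \<open>deviation_le\<close>, hence \<open>X\<^sup>2\<close> for \<open>m\<close>.\<close>
  define X where "X = max 5000 (5000 / \<epsilon>\<^sup>2)"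
  define m0 where "m0 = nat \<lceil>X\<^sup>2\<rceil> + 1"
  show ?thesis
  proof (intro exI[of _ m0] conjI allI impI ballI)
    show "m0 > 0" by (simp add: m0_def)
    fix m A assume m: "m \<ge> m0" and A: "A \<in> ruzsa_sets m"
    define k where "k = real (ruzsa_number m div 2)"
    define a where "a = real (card A)"
    define x where "x = sqrt (real m)"
    define y where "y = a\<^sup>2 / m - (k + 1/2)"
    have m_pos: "m > 0" using m by (simp add: m0_def)
    have floor: "real_of_int \<lfloor>real (ruzsa_number m) / 2\<rfloor> = k"
      using floor_divide_of_nat_eq[of "ruzsa_number m" 2, where ?'a = real] by (simp add: k_def)
    have "X\<^sup>2 \<le> real m" using m unfolding m0_def by linarith
    then have "X \<le> x" unfolding x_def by (rule real_le_rsqrt)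
    then have x: "x \<ge> 5000" "x \<ge> 5000 / \<epsilon>\<^sup>2" by (simp_all add: X_def)
    have xm: "real m = x\<^sup>2" by (simp add: x_def)
    have "2 * k \<le> real (ruzsa_number m)" unfolding k_def by linarith
    then have kx: "k \<le> 2 * x" using ruzsa_number_le_sqrt[OF m_pos] by (simp add: x_def)
    note quad = ruzsa_sets_quadratic[OF m_pos A, folded k_def a_def]
    have "2 * k * a / m + 2 * a ^ 3 / (real m)\<^sup>2 \<le> 2 * (3 * k + 1) * sqrt (2 * k + 1) / x"
      unfolding xm using quad(1) x by (intro error_term_le) (auto simp: a_def k_def xm)
    \<comment> \<open>Completing the square: \<open>(k + 1/2)\<^sup>2 - 4 * k\<close> is the
      radicand.\<close>
    then have "y\<^sup>2 \<le> k\<^sup>2 - 3 * k + 1/4 + 2 * (3 * k + 1) * sqrt (2 * k + 1) / x"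
      using quad(2) unfolding y_def power2_eq_square[of "_ - _"]
      by (simp add: algebra_simps power2_eq_square)
    then have "\<bar>y\<bar> \<le> sqrt (k\<^sup>2 - 3 * k + 1/4) + \<epsilon>"
      using kx assms x by (intro deviation_le[where x = x]) (auto simp: k_def)
    then have "k + 1/2 - sqrt (k\<^sup>2 - 3 * k + 1/4) - \<epsilon> \<le> a\<^sup>2 / m"
      "a\<^sup>2 / m \<le> k + 1/2 + sqrt (k\<^sup>2 - 3 * k + 1/4) + \<epsilon>"
      by (simp_all add: y_def abs_le_iff)
    then show "let k = real_of_int \<lfloor>real (ruzsa_number m) / 2\<rfloor> in
              (k + 1/2 - sqrt (k\<^sup>2 - 3 * k + 1/4) - \<epsilon>) * real m \<le> (real (card A))\<^sup>2 \<and>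
              (real (card A))\<^sup>2 \<le> (k + 1/2 + sqrt (k\<^sup>2 - 3 * k + 1/4) + \<epsilon>) * real m"
      using m_pos unfolding Let_def floor a_def
      by (simp add: pos_divide_le_eq pos_le_divide_eq)
  qed
qed

end
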